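(* Let $u_0\in C^{0,1}(\mathbb{R})$ be bounded with $u_0(0)=0$, $u_0(y)>0$ if $y<0$ and $-T_M<u_0(y)<0$ if $y>0$, and let $u_0|_{\mathbb{R}_\pm}\in C^{2,\delta}(\mathbb{R}_\pm)$ for some $\delta\in(0,\frac12)$. Let $(u_1,u_2,\dot s)$ be the unique bounded classical solution, for $t\in[0,t^*]$, where $[0,t^*]$ is the maximal interval of existence, of the problem $$\begin{cases} \partial_t u_1(t,y)-\dot{s}(t)\partial_y u_1(t,y)=\frac{K}{C}\, \partial_{y}^2 u_1(t,y)& y<0,\\ \partial_t u_2(t,y)-\dot{s}(t)\partial_y u_2(t,y)=\partial_{y}^2 u_2(t,y)-I_\alpha[u_2+T_M](t,y)& y>0,\\ u_1(t,0)=u_2(t,0)=0, &\\ u_1(0,y)=u_0(y)\ (y<0),\quad u_2(0,y)=u_0(y)\ (y>0),&\\ \dot{s}(t)=\frac{1}{L}\left( \partial_{y} u_2(t,0^+)-K\partial_{y} u_1(t,0^-)\right)&t>0,\\ s(0)=0.& \end{cases}$$ Then $u_1\ge 0$ and $-T_M\le u_2\le 0$. Moreover, $u_1(t,y)>0$ for all $y\in(a,b)$ for every bounded interval $(a,b)\subset(-\infty,0]$, and $-T_M<u_2(t,y)<0$ for all $y\in(a,b)$ for every bounded interval $(a,b)\subset[0,\infty)$.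
   Context: $K,C,L,\alpha,T_M>0$ are fixed constants. $\mathbb{R}_\mp$ are the negative/positive half-lines; $u_1$ is a function of $(t,y)$ with $y\in\mathbb{R}_-$ and $u_2$ with $y\in\mathbb{R}_+$. The radiation operator is $$I_\alpha[v](t,y)=v^4(t,y)-\int_0^\infty \frac{\alpha E_1(\alpha(y-\eta))}{2}v^4(t,\eta)\,d\eta,\qquad E_1(x)=\int_{|x|}^\infty \frac{e^{-r}}{r}\,dr .$$ For $U\subseteq\mathbb{R}$, $C^{k,\beta}(U)$ is the space of $k$-times continuously differentiable functions with all derivatives up to order $k$ bounded and with $\beta$-Hölder (Lipschitz if $\beta=1$) $k$-th derivative. The solution is understood in the following class, in which the problem is locally uniquely solvable: $u_1,u_2$ are bounded, with $\partial_t u_i,\partial_y u_i,\partial_y^2u_i$ continuous for $t>0$ up to $y=0$; $u_i$ and $\partial_y u_i$ are bounded, $u_i$ is $\frac{\delta}{2}$-Hölder in $t$ and $\partial_yu_i$ is $\delta$-Hölder in $y$; $s\in C^1$ up to $t=0$ with $\dot s$ $\frac{\delta}{2}$-Hölder; the initial data are attained continuously. The maximal interval of existence is the largest time interval on which this solution exists. *)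

theory Defs
  imports "HOL-Analysis.Analysis"
begin

definition holder_on :: "real \<Rightarrow> real set \<Rightarrow> (real \<Rightarrow> real) \<Rightarrow> bool" where
  "holder_on \<beta> U f \<longleftrightarrow> (\<exists>M. \<forall>x\<in>U. \<forall>y\<in>U. \<bar>f x - f y\<bar> \<le> M * \<bar>x - y\<bar> powr \<beta>)"

text \<open>The space \<open>C\<^sup>k\<^sup>,\<^sup>\<beta>(U)\<close>; \<open>D j\<close> is the \<open>j\<close>-th derivative of \<open>f\<close> on \<open>U\<close>.\<close>

definition C_holder :: "nat \<Rightarrow> real \<Rightarrow> real set \<Rightarrow> (real \<Rightarrow> real) \<Rightarrow> bool" where
  "C_holder k \<beta> U f \<longleftrightarrow>
    (\<exists>D :: nat \<Rightarrow> real \<Rightarrow> real.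
      (\<forall>y\<in>U. D 0 y = f y) \<and>
      (\<forall>j<k. \<forall>y\<in>U. (D j has_real_derivative D (Suc j) y) (at y within U)) \<and>
      (\<forall>j\<le>k. continuous_on U (D j) \<and> bounded (D j ` U)) \<and>
      holder_on \<beta> U (D k))"

text \<open>The exponential integral. \<open>E1 0\<close> is infinite in the literature and \<open>0\<close> here (the integrand
  is not integrable); this affects the integrand of \<open>radiation\<close> only on a null set.\<close>

definition E1 :: "real \<Rightarrow> real" where
  "E1 x = (LBINT r:{\<bar>x\<bar>..}. exp (- r) / r)"

definition radiation :: "real \<Rightarrow> (real \<Rightarrow> real \<Rightarrow> real) \<Rightarrow> real \<Rightarrow> real \<Rightarrow> real" where
  "radiation \<alpha> v t y =
    v t y ^ 4 - (LBINT \<eta>:{0..}. \<alpha> * E1 (\<alpha> * (y - \<eta>)) / 2 * v t \<eta> ^ 4)"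

text \<open>Regularity on \<open>[0,T] \<times> Y\<close> of one phase \<open>u\<close>, where \<open>Y\<close> is a closed half-line and
  \<open>ut, uy, uyy\<close> are the partial derivatives of \<open>u\<close>. They exist for \<open>t > 0\<close> and are one-sided at
  the boundary point of \<open>Y\<close> and at the final time. The Hoelder constant in one
  variable is uniform in the other.\<close>

definition phase_regular ::
  "real \<Rightarrow> real \<Rightarrow> real set \<Rightarrow> (real \<Rightarrow> real \<Rightarrow> real) \<Rightarrow> (real \<Rightarrow> real \<Rightarrow> real) \<Rightarrow>
   (real \<Rightarrow> real \<Rightarrow> real) \<Rightarrow> (real \<Rightarrow> real \<Rightarrow> real) \<Rightarrow> bool" where
  "phase_regular \<delta> T Y u ut uy uyy \<longleftrightarrow>
    continuous_on ({0..T} \<times> Y) (\<lambda>(t, y). u t y) \<and>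
    (\<forall>t\<in>{0<..T}. \<forall>y\<in>Y.
      ((\<lambda>\<tau>. u \<tau> y) has_real_derivative ut t y) (at t within {0..T}) \<and>
      (u t has_real_derivative uy t y) (at y within Y) \<and>
      (uy t has_real_derivative uyy t y) (at y within Y)) \<and>
    continuous_on ({0<..T} \<times> Y) (\<lambda>(t, y). ut t y) \<and>
    continuous_on ({0<..T} \<times> Y) (\<lambda>(t, y). uy t y) \<and>
    continuous_on ({0<..T} \<times> Y) (\<lambda>(t, y). uyy t y) \<and>
    bounded ((\<lambda>(t, y). u t y) ` ({0..T} \<times> Y)) \<and>
    bounded ((\<lambda>(t, y). uy t y) ` ({0<..T} \<times> Y)) \<and>
    (\<exists>M. \<forall>y\<in>Y. \<forall>t\<in>{0..T}. \<forall>\<tau>\<in>{0..T}. \<bar>u t y - u \<tau> y\<bar> \<le> M * \<bar>t - \<tau>\<bar> powr (\<delta> / 2)) \<and>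
    (\<exists>M. \<forall>t\<in>{0<..T}. \<forall>y\<in>Y. \<forall>z\<in>Y. \<bar>uy t y - uy t z\<bar> \<le> M * \<bar>y - z\<bar> powr \<delta>)"

text \<open>Bounded classical solutions on \<open>[0,T]\<close>; only the values of \<open>u\<^sub>1\<close> at \<open>y \<le> 0\<close> and of \<open>u\<^sub>2\<close> at
  \<open>y \<ge> 0\<close> matter. \<open>ds\<close> is the derivative of \<open>s\<close>.\<close>

definition classical_solution ::
  "real \<Rightarrow> real \<Rightarrow> real \<Rightarrow> real \<Rightarrow> real \<Rightarrow> real \<Rightarrow> (real \<Rightarrow> real) \<Rightarrow> real \<Rightarrow>
   (real \<Rightarrow> real \<Rightarrow> real) \<Rightarrow> (real \<Rightarrow> real \<Rightarrow> real) \<Rightarrow> (real \<Rightarrow> real) \<Rightarrow> bool" where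
  "classical_solution K C L \<alpha> TM \<delta> u0 T u1 u2 s \<longleftrightarrow>
    (\<exists>u1t u1y u1yy u2t u2y u2yy ds.
      phase_regular \<delta> T {..0} u1 u1t u1y u1yy \<and>
      phase_regular \<delta> T {0..} u2 u2t u2y u2yy \<and>
      (\<forall>t\<in>{0..T}. (s has_real_derivative ds t) (at t within {0..T})) \<and>
      continuous_on {0..T} ds \<and> holder_on (\<delta> / 2) {0..T} ds \<and>
      (\<forall>t\<in>{0<..T}. \<forall>y<0. u1t t y - ds t * u1y t y = K / C * u1yy t y) \<and>
      (\<forall>t\<in>{0<..T}. \<forall>y>0. u2t t y - ds t * u2y t y =
         u2yy t y - radiation \<alpha> (\<lambda>\<tau> \<eta>. u2 \<tau> \<eta> + TM) t y) \<and>
      (\<forall>t\<in>{0..T}. u1 t 0 = 0 \<and> u2 t 0 = 0) \<and>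
      (\<forall>y<0. u1 0 y = u0 y) \<and>
      (\<forall>y>0. u2 0 y = u0 y) \<and>
      (\<forall>t\<in>{0<..T}. ds t = 1 / L * (u2y t 0 - K * u1y t 0)) \<and>
      s 0 = 0)"

text \<open>Solutions on a nondegenerate time interval \<open>J\<close> starting at \<open>0\<close>, of the form \<open>[0,t\<^sub>*]\<close>,
  \<open>[0,t\<^sub>*)\<close> or \<open>[0,\<infinity>)\<close>. The bounds are uniform on each \<open>[0,T] \<subseteq> J\<close>, hence on all of \<open>J\<close> if
  \<open>J\<close> is compact.\<close>

definition classical_solution_on ::
  "real \<Rightarrow> real \<Rightarrow> real \<Rightarrow> real \<Rightarrow> real \<Rightarrow> real \<Rightarrow> (real \<Rightarrow> real) \<Rightarrow> real set \<Rightarrow>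
   (real \<Rightarrow> real \<Rightarrow> real) \<Rightarrow> (real \<Rightarrow> real \<Rightarrow> real) \<Rightarrow> (real \<Rightarrow> real) \<Rightarrow> bool" where
  "classical_solution_on K C L \<alpha> TM \<delta> u0 J u1 u2 s \<longleftrightarrow>
    is_interval J \<and> 0 \<in> J \<and> J \<subseteq> {0..} \<and> J \<noteq> {0} \<and>
    (\<forall>T\<in>J. 0 < T \<longrightarrow> classical_solution K C L \<alpha> TM \<delta> u0 T u1 u2 s)"

text \<open>\<open>J\<close> is the maximal interval of existence of the solution: the solution has no continuation
  to a larger time interval.\<close>

definition maximal_classical_solution ::
  "real \<Rightarrow> real \<Rightarrow> real \<Rightarrow> real \<Rightarrow> real \<Rightarrow> real \<Rightarrow> (real \<Rightarrow> real) \<Rightarrow> real set \<Rightarrow>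
   (real \<Rightarrow> real \<Rightarrow> real) \<Rightarrow> (real \<Rightarrow> real \<Rightarrow> real) \<Rightarrow> (real \<Rightarrow> real) \<Rightarrow> bool" where
  "maximal_classical_solution K C L \<alpha> TM \<delta> u0 J u1 u2 s \<longleftrightarrow>
    classical_solution_on K C L \<alpha> TM \<delta> u0 J u1 u2 s \<and>
    (\<forall>J' v1 v2 r.
      classical_solution_on K C L \<alpha> TM \<delta> u0 J' v1 v2 r \<and> J \<subseteq> J' \<and>
      (\<forall>t\<in>J. (\<forall>y\<le>0. v1 t y = u1 t y) \<and> (\<forall>y\<ge>0. v2 t y = u2 t y) \<and> r t = s t)
      \<longrightarrow> J' = J)"

end

theory Submission
  imports Defs
begin

text \<open>Once the solution is given, the boundary velocity \<open>ds\<close> is just a bounded drift coefficient,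
  and the two phases decouple: each of them solves a parabolic equation on a fixed half-line with
  given boundary value at \<open>y = 0\<close>. All the claims are then comparison statements for linear
  differential inequalities \<open>v\<^sub>t - b v\<^sub>y - \<kappa> v\<^sub>y\<^sub>y + c v \<ge> 0\<close> with bounded \<open>b\<close> and \<open>c\<close>, applied to
  \<open>u1\<close> in the reflected coordinate, to \<open>u2 + TM\<close> and to \<open>- u2\<close>.

  The weak inequalities come from the minimum principle on compact rectangles
  (\<open>supersolution_nonneg_interval\<close>). It passes to the half-line
  (\<open>supersolution_nonneg_half_line\<close>) by adding a small multiple of the supersolution
  \<open>exp (\<mu> t) (1 + y\<^sup>2)\<close>, which beats any bounded function far out. The strict inequalities
  (\<open>supersolution_pos_half_line\<close>) use that the initial data are already strictly positive inside:
  a compactly supported bump placed below them persists, with exponential decay in time, as a lower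
  barrier (\<open>supersolution_bump\<close>).

  What remains is the nonlocal radiation term. It has two properties: its kernel is nonnegative,
  and the kernel \<open>\<alpha> E1 (\<alpha> (y - \<eta>)) / 2\<close> has total mass at most \<open>1\<close>, so that it maps functions
  between \<open>0\<close> and \<open>G\<close> to functions between \<open>0\<close> and \<open>G\<close> (\<open>radiation_integral_le\<close>). The first
  property makes it a nonnegative source for \<open>u2 + TM\<close>. The upper bound \<open>u2 \<le> 0\<close> needs both, and
  since the nonlocal term sees the values of \<open>u2\<close> everywhere, it is reached by repeatedly halving
  a lower bound for \<open>- u2\<close> (\<open>second_phase_bounds\<close>).\<close>

section \<open>Comparison on bounded intervals\<close>

text \<open>The zero-order coefficient \<open>c\<close> and the source \<open>f\<close> are kept apart because the comparison
  principles need opposite kinds of information on them: \<open>c\<close> is merely bounded, of any sign,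
  whereas \<open>f\<close> must be nonnegative.\<close>

definition supersolution ::
  "real \<Rightarrow> (real \<Rightarrow> real \<Rightarrow> real) \<Rightarrow> (real \<Rightarrow> real \<Rightarrow> real) \<Rightarrow> (real \<Rightarrow> real \<Rightarrow> real) \<Rightarrow>
   real \<Rightarrow> real set \<Rightarrow> (real \<Rightarrow> real \<Rightarrow> real) \<Rightarrow> bool" where
  "supersolution \<kappa> b c f T Y v \<longleftrightarrow>
    continuous_on ({0..T} \<times> Y) (\<lambda>(t, y). v t y) \<and>
    (\<exists>vt vy vyy. \<forall>t\<in>{0<..T}. \<forall>y\<in>interior Y.
      ((\<lambda>\<tau>. v \<tau> y) has_real_derivative vt t y) (at t within {0..T}) \<and>
      (v t has_real_derivative vy t y) (at y) \<and>
      (vy t has_real_derivative vyy t y) (at y) \<and>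
      f t y \<le> vt t y - b t y * vy t y - \<kappa> * vyy t y + c t y * v t y)"

lemma supersolutionI:
  assumes "continuous_on ({0..T} \<times> Y) (\<lambda>(t, y). v t y)"
    and "\<And>t y. t \<in> {0<..T} \<Longrightarrow> y \<in> interior Y \<Longrightarrow>
      ((\<lambda>\<tau>. v \<tau> y) has_real_derivative vt t y) (at t within {0..T})"
    and "\<And>t y. t \<in> {0<..T} \<Longrightarrow> y \<in> interior Y \<Longrightarrow> (v t has_real_derivative vy t y) (at y)"
    and "\<And>t y. t \<in> {0<..T} \<Longrightarrow> y \<in> interior Y \<Longrightarrow> (vy t has_real_derivative vyy t y) (at y)"
    and "\<And>t y. t \<in> {0<..T} \<Longrightarrow> y \<in> interior Y \<Longrightarrow>
      f t y \<le> vt t y - b t y * vy t y - \<kappa> * vyy t y + c t y * v t y"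
  shows "supersolution \<kappa> b c f T Y v"
  unfolding supersolution_def using assms by blast

lemma supersolution_subset:
  assumes "supersolution \<kappa> b c f T Y v" "X \<subseteq> Y"
  shows "supersolution \<kappa> b c f T X v"
proof -
  have "y \<in> interior Y" if "y \<in> interior X" for y
    using interior_mono[OF assms(2)] that by blast
  moreover have "continuous_on ({0..T} \<times> X) (\<lambda>(t, y). v t y)"
    by (rule continuous_on_subset[of "{0..T} \<times> Y"])
      (use assms in \<open>auto simp: supersolution_def\<close>)
  ultimately show ?thesis
    using assms(1) unfolding supersolution_def by fast
qed

lemma supersolution_add:
  assumes "supersolution \<kappa> b c f T Y v" "supersolution \<kappa> b c g T Y w"
  shows "supersolution \<kappa> b c (\<lambda>t y. f t y + g t y) T Y (\<lambda>t y. v t y + w t y)"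
proof -
  obtain vt vy vyy where v: "\<forall>t\<in>{0<..T}. \<forall>y\<in>interior Y.
      ((\<lambda>\<tau>. v \<tau> y) has_real_derivative vt t y) (at t within {0..T}) \<and>
      (v t has_real_derivative vy t y) (at y) \<and>
      (vy t has_real_derivative vyy t y) (at y) \<and>
      f t y \<le> vt t y - b t y * vy t y - \<kappa> * vyy t y + c t y * v t y"
    using assms(1) unfolding supersolution_def by blast
  obtain wt wy wyy where w: "\<forall>t\<in>{0<..T}. \<forall>y\<in>interior Y.
      ((\<lambda>\<tau>. w \<tau> y) has_real_derivative wt t y) (at t within {0..T}) \<and>
      (w t has_real_derivative wy t y) (at y) \<and>
      (wy t has_real_derivative wyy t y) (at y) \<and>
      g t y \<le> wt t y - b t y * wy t y - \<kappa> * wyy t y + c t y * w t y"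
    using assms(2) unfolding supersolution_def by blast
  show ?thesis
  proof (rule supersolutionI[where vt = "\<lambda>t y. vt t y + wt t y" and vy = "\<lambda>t y. vy t y + wy t y"
        and vyy = "\<lambda>t y. vyy t y + wyy t y"])
    show "continuous_on ({0..T} \<times> Y) (\<lambda>(t, y). v t y + w t y)"
      using assms unfolding supersolution_def by (auto simp: split_def intro!: continuous_intros)
  next
    fix t y assume ty: "t \<in> {0<..T}" "y \<in> interior Y"
    note V = v[rule_format, OF ty] and W = w[rule_format, OF ty]
    show "((\<lambda>\<tau>. v \<tau> y + w \<tau> y) has_real_derivative vt t y + wt t y) (at t within {0..T})"
      "((\<lambda>y. v t y + w t y) has_real_derivative vy t y + wy t y) (at y)"
      "((\<lambda>y. vy t y + wy t y) has_real_derivative vyy t y + wyy t y) (at y)"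
      using V W by (auto intro!: DERIV_add)
    show "f t y + g t y \<le> vt t y + wt t y - b t y * (vy t y + wy t y) - \<kappa> * (vyy t y + wyy t y)
        + c t y * (v t y + w t y)"
      using V W by (auto simp: algebra_simps)
  qed
qed

text \<open>At a negative minimum over a compact rectangle that lies off the parabolic boundary, the
  derivatives have the signs excluded by \<open>no_min\<close>. The time derivative is only
  controlled from the left, since the minimum may be attained at the final time.\<close>

lemma parabolic_minimum_principle:
  fixes v vt vy vyy :: "real \<Rightarrow> real \<Rightarrow> real"
  assumes cont: "continuous_on ({0..T} \<times> {a..e}) (\<lambda>(t, y). v t y)"
    and dt: "\<And>t y. t \<in> {0<..T} \<Longrightarrow> y \<in> {a<..<e} \<Longrightarrow>
      ((\<lambda>\<tau>. v \<tau> y) has_real_derivative vt t y) (at t within {0..T})"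
    and dy: "\<And>t y. t \<in> {0<..T} \<Longrightarrow> y \<in> {a<..<e} \<Longrightarrow> (v t has_real_derivative vy t y) (at y)"
    and dyy: "\<And>t y. t \<in> {0<..T} \<Longrightarrow> y \<in> {a<..<e} \<Longrightarrow>
      (vy t has_real_derivative vyy t y) (at y)"
    and initial: "\<And>y. y \<in> {a..e} \<Longrightarrow> 0 \<le> v 0 y"
    and left: "\<And>t. t \<in> {0..T} \<Longrightarrow> 0 \<le> v t a"
    and right: "\<And>t. t \<in> {0..T} \<Longrightarrow> 0 \<le> v t e"
    and no_min: "\<And>t y. t \<in> {0<..T} \<Longrightarrow> y \<in> {a<..<e} \<Longrightarrow> v t y < 0 \<Longrightarrow> vt t y \<le> 0 \<Longrightarrow>
      vy t y = 0 \<Longrightarrow> 0 \<le> vyy t y \<Longrightarrow> False"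
    and t: "t \<in> {0..T}" and y: "y \<in> {a..e}"
  shows "0 \<le> v t y"
proof (rule ccontr)
  assume neg: "\<not> 0 \<le> v t y"
  have "compact ({0..T} \<times> {a..e})"
    by (intro compact_Times compact_Icc)
  then obtain p where p: "p \<in> {0..T} \<times> {a..e}"
    "\<forall>q\<in>{0..T} \<times> {a..e}. (\<lambda>(t, y). v t y) p \<le> (\<lambda>(t, y). v t y) q"
    using continuous_attains_inf[OF _ _ cont] t y by blast
  obtain t0 y0 where p_eq: "p = (t0, y0)"
    by (cases p)
  have t0: "t0 \<in> {0..T}" and y0: "y0 \<in> {a..e}"
    using p(1) p_eq by auto
  have le: "v t0 y0 \<le> v \<tau> x" if "\<tau> \<in> {0..T}" "x \<in> {a..e}" for \<tau> x
    using p(2) p_eq that by auto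
  have neg0: "v t0 y0 < 0"
    using le[OF t y] neg by simp
  have "t0 \<noteq> 0" "y0 \<noteq> a" "y0 \<noteq> e"
    using neg0 initial[OF y0] left[OF t0] right[OF t0] by auto
  then have t0': "t0 \<in> {0<..T}" and y0': "y0 \<in> {a<..<e}"
    using t0 y0 by auto
  define d where "d = min (y0 - a) (e - y0)"
  have d: "d > 0"
    using y0' by (auto simp: d_def)
  have "vt t0 y0 \<le> 0"
  proof (rule ccontr)
    assume "\<not> vt t0 y0 \<le> 0"
    then obtain r where r: "r > 0"
      "\<forall>h>0. t0 - h \<in> {0..T} \<longrightarrow> h < r \<longrightarrow> v (t0 - h) y0 < v t0 y0"
      using has_real_derivative_pos_inc_left[OF dt[OF t0' y0']] by auto
    define h where "h = min t0 (r / 2)"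
    have "h > 0" "h < r" "t0 - h \<in> {0..T}"
      using r(1) t0' by (auto simp: h_def min_def)
    then show False
      using r(2) le[of "t0 - h" y0] y0 by force
  qed
  moreover have zero: "vy t0 y0 = 0"
    using dy[OF t0' y0'] d
  proof (rule DERIV_local_min)
    show "\<forall>x. \<bar>y0 - x\<bar> < d \<longrightarrow> v t0 y0 \<le> v t0 x"
      using le[OF t0] by (auto simp: d_def abs_less_iff)
  qed
  moreover have "0 \<le> vyy t0 y0"
  proof (rule ccontr)
    assume "\<not> 0 \<le> vyy t0 y0"
    then obtain r where r: "r > 0" "\<forall>h>0. h < r \<longrightarrow> vy t0 (y0 + h) < vy t0 y0"
      using DERIV_neg_dec_right[OF dyy[OF t0' y0']] by auto
    define h where "h = min d r / 2"
    have h: "h > 0" "h < r" "h < d"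
      using r(1) d by (auto simp: h_def min_def)
    have "(v t0 has_real_derivative vy t0 x) (at x)" if "y0 \<le> x" "x \<le> y0 + h" for x
      using dy[OF t0'] that h y0' by (auto simp: d_def)
    then obtain x where x: "y0 < x" "x < y0 + h" "v t0 (y0 + h) - v t0 y0 = h * vy t0 x"
      using MVT2[of y0 "y0 + h" "v t0" "vy t0"] h(1) by auto
    have "vy t0 x < 0"
      using r(2)[rule_format, of "x - y0"] x h zero by auto
    then have "v t0 (y0 + h) < v t0 y0"
      using x(3) mult_pos_neg[of h "vy t0 x"] h(1) by simp
    then show False
      using le[OF t0, of "y0 + h"] h y0' by (auto simp: d_def)
  qed
  ultimately show False
    using no_min[OF t0' y0' neg0] by blast
qed

text \<open>The weight \<open>exp (- \<mu> t)\<close> adds \<open>\<mu>\<close> to the zero-order coefficient and makes it positive, so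
  that a negative interior minimum contradicts the differential inequality.\<close>

lemma supersolution_nonneg_interval:
  assumes sup: "supersolution \<kappa> b c f T {a..e} v"
    and \<kappa>: "\<kappa> \<ge> 0"
    and f: "\<And>t y. t \<in> {0<..T} \<Longrightarrow> y \<in> {a<..<e} \<Longrightarrow> 0 \<le> f t y"
    and c: "\<And>t y. t \<in> {0<..T} \<Longrightarrow> y \<in> {a<..<e} \<Longrightarrow> \<bar>c t y\<bar> \<le> M"
    and initial: "\<And>y. y \<in> {a..e} \<Longrightarrow> 0 \<le> v 0 y"
    and left: "\<And>t. t \<in> {0..T} \<Longrightarrow> 0 \<le> v t a"
    and right: "\<And>t. t \<in> {0..T} \<Longrightarrow> 0 \<le> v t e"
    and t: "t \<in> {0..T}" and y: "y \<in> {a..e}"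
  shows "0 \<le> v t y"
proof -
  define \<mu> where "\<mu> = M + 1"
  obtain vt vy vyy where v: "\<forall>t\<in>{0<..T}. \<forall>y\<in>{a<..<e}.
      ((\<lambda>\<tau>. v \<tau> y) has_real_derivative vt t y) (at t within {0..T}) \<and>
      (v t has_real_derivative vy t y) (at y) \<and>
      (vy t has_real_derivative vyy t y) (at y) \<and>
      f t y \<le> vt t y - b t y * vy t y - \<kappa> * vyy t y + c t y * v t y"
    using sup unfolding supersolution_def interior_atLeastAtMost_real by blast
  have "0 \<le> exp (- \<mu> * t) * v t y"
  proof (rule parabolic_minimum_principle[where v = "\<lambda>t y. exp (- \<mu> * t) * v t y"
        and vt = "\<lambda>t y. exp (- \<mu> * t) * (vt t y - \<mu> * v t y)"
        and vy = "\<lambda>t y. exp (- \<mu> * t) * vy t y"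
        and vyy = "\<lambda>t y. exp (- \<mu> * t) * vyy t y", OF _ _ _ _ _ _ _ _ t y])
    show "continuous_on ({0..T} \<times> {a..e}) (\<lambda>(t, y). exp (- \<mu> * t) * v t y)"
      using sup unfolding supersolution_def by (auto simp: split_def intro!: continuous_intros)
  next
    fix t y assume ty: "t \<in> {0<..T}" "y \<in> {a<..<e}"
    note V = v[rule_format, OF ty]
    show "((\<lambda>\<tau>. exp (- \<mu> * \<tau>) * v \<tau> y) has_real_derivative
        exp (- \<mu> * t) * (vt t y - \<mu> * v t y)) (at t within {0..T})"
      using V by (auto intro!: derivative_eq_intros simp: algebra_simps)
    show "((\<lambda>y. exp (- \<mu> * t) * v t y) has_real_derivative exp (- \<mu> * t) * vy t y) (at y)"
      "((\<lambda>y. exp (- \<mu> * t) * vy t y) has_real_derivative exp (- \<mu> * t) * vyy t y) (at y)"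
      using V by (auto intro!: DERIV_cmult)
    assume "exp (- \<mu> * t) * v t y < 0" "exp (- \<mu> * t) * (vt t y - \<mu> * v t y) \<le> 0"
      "exp (- \<mu> * t) * vy t y = 0" "0 \<le> exp (- \<mu> * t) * vyy t y"
    then have s: "v t y < 0" "vt t y \<le> \<mu> * v t y" "vy t y = 0" "0 \<le> vyy t y"
      by (auto simp: mult_less_0_iff mult_le_0_iff zero_le_mult_iff)
    have "0 \<le> (\<mu> + c t y) * v t y"
      using V f[OF ty] s mult_nonneg_nonneg[OF \<kappa> s(4)] by (auto simp: algebra_simps)
    moreover have "\<mu> + c t y > 0"
      using c[OF ty] by (auto simp: \<mu>_def)
    ultimately show False
      using s(1) by (simp add: zero_le_mult_iff)
  qed (use initial left right in auto)
  then show ?thesis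
    by (simp add: zero_le_mult_iff)
qed

section \<open>Comparison and positivity on the half-line\<close>

text \<open>This function supplies the growth in \<open>y\<close> that replaces a boundary condition at infinity.\<close>

lemma supersolution_growth:
  assumes \<kappa>: "\<kappa> \<ge> 0" and \<epsilon>: "\<epsilon> \<ge> 0"
    and b: "\<And>t y. t \<in> {0<..T} \<Longrightarrow> \<bar>b t y\<bar> \<le> B"
    and c: "\<And>t y. t \<in> {0<..T} \<Longrightarrow> y \<in> interior Y \<Longrightarrow> \<bar>c t y\<bar> \<le> M"
  shows "supersolution \<kappa> b c (\<lambda>t y. 0) T Y
    (\<lambda>t y. \<epsilon> * exp ((B + 2 * \<kappa> + M) * t) * (1 + y\<^sup>2))"
proof -
  define \<mu> where "\<mu> = B + 2 * \<kappa> + M"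
  have "supersolution \<kappa> b c (\<lambda>t y. 0) T Y (\<lambda>t y. \<epsilon> * exp (\<mu> * t) * (1 + y\<^sup>2))"
  proof (rule supersolutionI[where vt = "\<lambda>t y. \<epsilon> * exp (\<mu> * t) * (\<mu> * (1 + y\<^sup>2))"
        and vy = "\<lambda>t y. \<epsilon> * exp (\<mu> * t) * (2 * y)" and vyy = "\<lambda>t y. \<epsilon> * exp (\<mu> * t) * 2"])
    show "continuous_on ({0..T} \<times> Y) (\<lambda>(t, y). \<epsilon> * exp (\<mu> * t) * (1 + y\<^sup>2))"
      by (auto simp: split_def intro!: continuous_intros)
  next
    fix t y assume ty: "t \<in> {0<..T}" "y \<in> interior Y"
    show "((\<lambda>\<tau>. \<epsilon> * exp (\<mu> * \<tau>) * (1 + y\<^sup>2)) has_real_derivative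
        \<epsilon> * exp (\<mu> * t) * (\<mu> * (1 + y\<^sup>2))) (at t within {0..T})"
      "((\<lambda>y. \<epsilon> * exp (\<mu> * t) * (1 + y\<^sup>2)) has_real_derivative \<epsilon> * exp (\<mu> * t) * (2 * y)) (at y)"
      "((\<lambda>y. \<epsilon> * exp (\<mu> * t) * (2 * y)) has_real_derivative \<epsilon> * exp (\<mu> * t) * 2) (at y)"
      by (auto intro!: derivative_eq_intros)
    have "b t y * (2 * y) \<le> \<bar>b t y\<bar> * \<bar>2 * y\<bar>"
      by (metis abs_ge_self abs_mult)
    also have "\<dots> \<le> B * (1 + y\<^sup>2)"
    proof (rule mult_mono)
      show "\<bar>2 * y\<bar> \<le> 1 + y\<^sup>2"
        using zero_le_power2[of "y - 1"] zero_le_power2[of "y + 1"]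
        by (auto simp: power2_eq_square algebra_simps abs_if)
    qed (use b[OF ty(1), of y] in auto)
    finally have 1: "b t y * (2 * y) \<le> B * (1 + y\<^sup>2)" .
    have 2: "- (c t y * (1 + y\<^sup>2)) \<le> M * (1 + y\<^sup>2)"
      using mult_right_mono[of "- c t y" M "1 + y\<^sup>2"] c[OF ty] by (auto simp: abs_le_iff)
    have 3: "\<kappa> * 2 \<le> 2 * \<kappa> * (1 + y\<^sup>2)"
      using \<kappa> by (simp add: algebra_simps)
    have "0 \<le> \<mu> * (1 + y\<^sup>2) - b t y * (2 * y) - \<kappa> * 2 + c t y * (1 + y\<^sup>2)"
      using 1 2 3 unfolding \<mu>_def by (simp add: algebra_simps)
    then have "0 \<le> \<epsilon> * exp (\<mu> * t)
        * (\<mu> * (1 + y\<^sup>2) - b t y * (2 * y) - \<kappa> * 2 + c t y * (1 + y\<^sup>2))"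
      using \<epsilon> by (intro mult_nonneg_nonneg) auto
    then show "0 \<le> \<epsilon> * exp (\<mu> * t) * (\<mu> * (1 + y\<^sup>2)) - b t y * (\<epsilon> * exp (\<mu> * t) * (2 * y))
        - \<kappa> * (\<epsilon> * exp (\<mu> * t) * 2) + c t y * (\<epsilon> * exp (\<mu> * t) * (1 + y\<^sup>2))"
      by (simp add: algebra_simps)
  qed
  then show ?thesis
    by (simp add: \<mu>_def)
qed

lemma supersolution_nonneg_half_line:
  assumes sup: "supersolution \<kappa> b c f T {0..} v"
    and \<kappa>: "\<kappa> \<ge> 0"
    and f: "\<And>t y. t \<in> {0<..T} \<Longrightarrow> y > 0 \<Longrightarrow> 0 \<le> f t y"
    and b: "\<And>t y. t \<in> {0<..T} \<Longrightarrow> \<bar>b t y\<bar> \<le> B"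
    and c: "\<And>t y. t \<in> {0<..T} \<Longrightarrow> y > 0 \<Longrightarrow> \<bar>c t y\<bar> \<le> M"
    and below: "\<And>t y. t \<in> {0..T} \<Longrightarrow> y \<ge> 0 \<Longrightarrow> - N \<le> v t y"
    and initial: "\<And>y. y \<ge> 0 \<Longrightarrow> 0 \<le> v 0 y"
    and left: "\<And>t. t \<in> {0..T} \<Longrightarrow> 0 \<le> v t 0"
    and t: "t \<in> {0..T}" and y: "y \<ge> 0"
  shows "0 \<le> v t y"
proof (cases "t = 0")
  case True
  then show ?thesis using initial y by simp
next
  case False
  then have t': "t \<in> {0<..T}"
    using t by auto
  define \<mu> where "\<mu> = B + 2 * \<kappa> + M"
  have \<mu>: "\<mu> \<ge> 0"
    using b[OF t', of 1] c[OF t', of 1] \<kappa> by (auto simp: \<mu>_def)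
  define A where "A = exp (\<mu> * t) * (1 + y\<^sup>2)"
  have A: "A > 0"
    by (auto simp: A_def intro!: mult_pos_pos add_pos_nonneg)
  have "0 \<le> v t y + \<epsilon> * A" if \<epsilon>: "\<epsilon> > 0" for \<epsilon>
  proof -
    define h where "h = (\<lambda>t y. \<epsilon> * exp (\<mu> * t) * (1 + y\<^sup>2))"
    have h0: "h t y \<ge> 0" for t y
      using \<epsilon> by (auto simp: h_def)
    \<comment> \<open>Far enough out for the quadratic growth to beat the lower bound on \<open>v\<close>.\<close>
    define R where "R = max y (max 1 (N / \<epsilon>))"
    have "N \<le> \<epsilon> * R"
      using \<epsilon> mult_left_mono[of "N / \<epsilon>" R \<epsilon>] by (simp add: R_def)
    also have "\<dots> \<le> \<epsilon> * (1 + R\<^sup>2)"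
    proof (rule mult_left_mono)
      have "1 \<le> R"
        by (simp add: R_def)
      then show "R \<le> 1 + R\<^sup>2"
        using self_le_power[of R 2] by simp
    qed (use \<epsilon> in simp)
    finally have "N \<le> \<epsilon> * (1 + R\<^sup>2)" .
    have right: "0 \<le> v \<tau> R + h \<tau> R" if "\<tau> \<in> {0..T}" for \<tau>
    proof -
      have "\<epsilon> * (1 + R\<^sup>2) \<le> h \<tau> R"
        using \<epsilon> \<mu> that mult_right_mono[of 1 "exp (\<mu> * \<tau>)" "1 + R\<^sup>2"] by (simp add: h_def)
      moreover have "R \<ge> 0"
        by (simp add: R_def)
      ultimately show ?thesis
        using \<open>N \<le> \<epsilon> * (1 + R\<^sup>2)\<close> below[OF that, of R] by linarith
    qed
    have "supersolution \<kappa> b c (\<lambda>t y. 0) T {0..} h"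
      unfolding h_def \<mu>_def using \<kappa> \<epsilon> b c by (intro supersolution_growth) auto
    from supersolution_subset[OF supersolution_add[OF sup this], of "{0..R}"]
    have "supersolution \<kappa> b c (\<lambda>t y. f t y + 0) T {0..R} (\<lambda>t y. v t y + h t y)"
      by auto
    then have "0 \<le> v t y + h t y"
    proof (rule supersolution_nonneg_interval[OF _ \<kappa>])
      show "y \<in> {0..R}"
        using y by (auto simp: R_def)
    qed (use f c initial left h0 right t in auto)
    then show ?thesis
      by (simp add: h_def A_def mult.assoc)
  qed
  from this[of "e / A" for e] have "0 \<le> v t y + e" if "e > 0" for e
    using A that by simp
  then show ?thesis
    by (rule field_le_epsilon)
qed

text \<open>The bump \<open>r\<^sup>2\<close> with \<open>r = (y - a) (e - y)\<close> vanishes to second order at both ends of the interval.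
  With \<open>D = e - a\<close> one has \<open>(r')\<^sup>2 = D\<^sup>2 - 4 r\<close> and \<open>r'' = -2\<close>, so that \<open>\<kappa> (r\<^sup>2)'' = 2 \<kappa> D\<^sup>2 - 12 \<kappa> r\<close>.
  Near the ends this is positive and dominates the drift term, which is of order \<open>r\<close>; away from
  them the decay in time dominates, at the price \<open>\<mu> r\<^sup>2\<close>. The rate \<open>\<mu>\<close> comes from completing the
  square in \<open>r\<close>.\<close>

lemma supersolution_bump:
  assumes \<kappa>: "\<kappa> > 0" and \<epsilon>: "\<epsilon> \<ge> 0" and "a < e"
    and b: "\<And>t y. t \<in> {0<..T} \<Longrightarrow> \<bar>b t y\<bar> \<le> B"
    and c: "\<And>t y. t \<in> {0<..T} \<Longrightarrow> y \<in> {a<..<e} \<Longrightarrow> \<bar>c t y\<bar> \<le> M"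
  defines "\<mu> \<equiv> M + (12 * \<kappa> + 2 * B * (e - a))\<^sup>2 / (8 * \<kappa> * (e - a)\<^sup>2)"
  shows "supersolution \<kappa> b c (\<lambda>t y. 0) T {a..e}
    (\<lambda>t y. - \<epsilon> * exp (- \<mu> * t) * ((y - a) * (e - y))\<^sup>2)"
proof (rule supersolutionI[where
      vt = "\<lambda>t y. \<epsilon> * exp (- \<mu> * t) * (\<mu> * ((y - a) * (e - y))\<^sup>2)"
      and vy = "\<lambda>t y. - \<epsilon> * exp (- \<mu> * t) * (2 * ((y - a) * (e - y)) * (a + e - 2 * y))"
      and vyy = "\<lambda>t y. - \<epsilon> * exp (- \<mu> * t) *
        (2 * (a + e - 2 * y)\<^sup>2 - 4 * ((y - a) * (e - y)))"])
  show "continuous_on ({0..T} \<times> {a..e}) (\<lambda>(t, y). - \<epsilon> * exp (- \<mu> * t) * ((y - a) * (e - y))\<^sup>2)"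
    by (auto simp: split_def intro!: continuous_intros)
next
  fix t y assume ty: "t \<in> {0<..T}" "y \<in> interior {a..e}"
  then have y: "y \<in> {a<..<e}"
    by (simp add: interior_atLeastAtMost_real)
  show "((\<lambda>\<tau>. - \<epsilon> * exp (- \<mu> * \<tau>) * ((y - a) * (e - y))\<^sup>2) has_real_derivative
      \<epsilon> * exp (- \<mu> * t) * (\<mu> * ((y - a) * (e - y))\<^sup>2)) (at t within {0..T})"
    by (auto intro!: derivative_eq_intros)
  show "((\<lambda>y. - \<epsilon> * exp (- \<mu> * t) * ((y - a) * (e - y))\<^sup>2) has_real_derivative
      - \<epsilon> * exp (- \<mu> * t) * (2 * ((y - a) * (e - y)) * (a + e - 2 * y))) (at y)"
    by (auto intro!: derivative_eq_intros simp: algebra_simps)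
  show "((\<lambda>y. - \<epsilon> * exp (- \<mu> * t) * (2 * ((y - a) * (e - y)) * (a + e - 2 * y)))
      has_real_derivative - \<epsilon> * exp (- \<mu> * t) *
        (2 * (a + e - 2 * y)\<^sup>2 - 4 * ((y - a) * (e - y)))) (at y)"
    by (auto intro!: derivative_eq_intros simp: algebra_simps power2_eq_square)
  define D where "D = e - a"
  define r where "r = (y - a) * (e - y)"
  define r' where "r' = a + e - 2 * y"
  define A where "A = 12 * \<kappa> + 2 * B * D"
  have D: "D > 0"
    using \<open>a < e\<close> by (simp add: D_def)
  have r: "r \<ge> 0"
    using y by (auto simp: r_def)
  have r'_sq: "r'\<^sup>2 = D\<^sup>2 - 4 * r"
    by (simp add: r'_def r_def D_def power2_eq_square algebra_simps)
  have "b t y * r' \<ge> - (B * D)"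
  proof -
    have "\<bar>b t y * r'\<bar> \<le> B * D"
      unfolding abs_mult using b[OF ty(1), of y] y by (intro mult_mono) (auto simp: r'_def D_def)
    then show ?thesis by simp
  qed
  then have drift: "- (2 * B * D * r) \<le> b t y * (2 * r * r')"
    using mult_right_mono[of "- (B * D)" "b t y * r'" "2 * r"] r by (simp add: algebra_simps)
  have potential: "c t y * r\<^sup>2 \<le> M * r\<^sup>2"
    using c[OF ty(1) y] by (intro mult_right_mono) (auto simp: abs_le_iff)
  have square: "A * r \<le> 2 * \<kappa> * D\<^sup>2 + A\<^sup>2 / (8 * \<kappa> * D\<^sup>2) * r\<^sup>2"
  proof -
    have "0 \<le> (4 * \<kappa> * D\<^sup>2 - A * r)\<^sup>2 / (8 * \<kappa> * D\<^sup>2)"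
      using \<kappa> by simp
    also have "\<dots> = 2 * \<kappa> * D\<^sup>2 - A * r + A\<^sup>2 / (8 * \<kappa> * D\<^sup>2) * r\<^sup>2"
      using \<kappa> D by (simp add: field_simps power2_eq_square)
    finally show ?thesis by simp
  qed
  have "0 \<le> \<mu> * r\<^sup>2 + b t y * (2 * r * r') + \<kappa> * (2 * r'\<^sup>2 - 4 * r) - c t y * r\<^sup>2"
    using drift potential square
    unfolding r'_sq \<mu>_def D_def[symmetric] A_def[symmetric]
    by (simp add: algebra_simps A_def)
  then have "0 \<le> \<epsilon> * exp (- \<mu> * t) *
      (\<mu> * r\<^sup>2 + b t y * (2 * r * r') + \<kappa> * (2 * r'\<^sup>2 - 4 * r) - c t y * r\<^sup>2)"
    using \<epsilon> by (intro mult_nonneg_nonneg) auto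
  then have "0 \<le> \<epsilon> * exp (- \<mu> * t) * (\<mu> * r\<^sup>2)
      - b t y * (- \<epsilon> * exp (- \<mu> * t) * (2 * r * r'))
      - \<kappa> * (- \<epsilon> * exp (- \<mu> * t) * (2 * r'\<^sup>2 - 4 * r))
      + c t y * (- \<epsilon> * exp (- \<mu> * t) * r\<^sup>2)"
    by (simp add: algebra_simps)
  then show "0 \<le> \<epsilon> * exp (- \<mu> * t) * (\<mu> * ((y - a) * (e - y))\<^sup>2)
      - b t y * (- \<epsilon> * exp (- \<mu> * t) * (2 * ((y - a) * (e - y)) * (a + e - 2 * y)))
      - \<kappa> * (- \<epsilon> * exp (- \<mu> * t) * (2 * (a + e - 2 * y)\<^sup>2 - 4 * ((y - a) * (e - y))))
      + c t y * (- \<epsilon> * exp (- \<mu> * t) * ((y - a) * (e - y))\<^sup>2)"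
    by (simp only: r_def r'_def)
qed

text \<open>The initial values are positive on all of the open half-line, so around \<open>y\<close> a small multiple
  of the bump lies below \<open>v\<close> at time \<open>0\<close>. It vanishes at the ends of its interval, where \<open>v\<close> is
  nonnegative, and therefore stays below \<open>v\<close>.\<close>

lemma supersolution_pos_half_line:
  assumes sup: "supersolution \<kappa> b c f T {0..} v"
    and \<kappa>: "\<kappa> > 0"
    and f: "\<And>t y. t \<in> {0<..T} \<Longrightarrow> y > 0 \<Longrightarrow> 0 \<le> f t y"
    and b: "\<And>t y. t \<in> {0<..T} \<Longrightarrow> \<bar>b t y\<bar> \<le> B"
    and c: "\<And>t y. t \<in> {0<..T} \<Longrightarrow> y > 0 \<Longrightarrow> \<bar>c t y\<bar> \<le> M"
    and nonneg: "\<And>t y. t \<in> {0..T} \<Longrightarrow> y \<ge> 0 \<Longrightarrow> 0 \<le> v t y"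
    and initial: "\<And>y. y > 0 \<Longrightarrow> 0 < v 0 y"
    and t: "t \<in> {0..T}" and y: "y > 0"
  shows "0 < v t y"
proof -
  define a where "a = y / 2"
  define e where "e = 2 * y"
  have ae: "0 < a" "a < y" "y < e" "a < e"
    using y by (auto simp: a_def e_def)
  have cont: "continuous_on ({0..T} \<times> {0..}) (\<lambda>(t, y). v t y)"
    using sup by (simp add: supersolution_def)
  have "continuous_on {a..e} (v 0)"
    using continuous_on_compose2[OF cont, of "{a..e}" "\<lambda>y. (0, y)"] ae t
    by (auto simp: image_subset_iff continuous_on_Pair)
  then obtain y1 where y1: "y1 \<in> {a..e}" "\<forall>x\<in>{a..e}. v 0 y1 \<le> v 0 x"
    using continuous_attains_inf[of "{a..e}" "v 0"] ae by auto
  define \<epsilon> where "\<epsilon> = v 0 y1 / ((e - a)\<^sup>2)\<^sup>2"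
  have \<epsilon>: "\<epsilon> > 0"
    using initial[of y1] y1 ae by (auto simp: \<epsilon>_def)
  define \<mu> where "\<mu> = M + (12 * \<kappa> + 2 * B * (e - a))\<^sup>2 / (8 * \<kappa> * (e - a)\<^sup>2)"
  define \<phi> where "\<phi> = (\<lambda>t y. - \<epsilon> * exp (- \<mu> * t) * ((y - a) * (e - y))\<^sup>2)"
  have "supersolution \<kappa> b c (\<lambda>t y. 0) T {a..e} \<phi>"
    unfolding \<phi>_def \<mu>_def using \<kappa> \<epsilon> ae b c by (intro supersolution_bump) auto
  from supersolution_add[OF supersolution_subset[OF sup, of "{a..e}"] this]
  have "supersolution \<kappa> b c (\<lambda>t y. f t y + 0) T {a..e} (\<lambda>t y. v t y + \<phi> t y)"
    using ae by auto
  then have "0 \<le> v t y + \<phi> t y"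
  proof (rule supersolution_nonneg_interval[where M = M])
    fix x assume x: "x \<in> {a..e}"
    have "((x - a) * (e - x))\<^sup>2 \<le> ((e - a)\<^sup>2)\<^sup>2"
      using x unfolding power2_eq_square[of "e - a"]
      by (intro power_mono mult_mono mult_nonneg_nonneg) auto
    then have "\<epsilon> * ((x - a) * (e - x))\<^sup>2 \<le> \<epsilon> * ((e - a)\<^sup>2)\<^sup>2"
      using \<epsilon> by (intro mult_left_mono) auto
    also have "\<dots> = v 0 y1"
      using ae by (simp add: \<epsilon>_def)
    also have "\<dots> \<le> v 0 x"
      using y1 x by blast
    finally show "0 \<le> v 0 x + \<phi> 0 x"
      by (simp add: \<phi>_def)
  next
    show "0 \<le> v \<tau> a + \<phi> \<tau> a" "0 \<le> v \<tau> e + \<phi> \<tau> e" if "\<tau> \<in> {0..T}" for \<tau>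
      using nonneg[OF that] ae by (auto simp: \<phi>_def)
  qed (use \<kappa> f c t ae in auto)
  moreover have "\<phi> t y < 0"
    using \<epsilon> ae by (auto simp: \<phi>_def)
  ultimately show ?thesis
    by simp
qed

section \<open>The radiation kernel\<close>

text \<open>The estimate is unconditional because an integral that does not exist has the value 0.\<close>

lemma ennreal_integral_le_nn_integral:
  fixes f :: "'a \<Rightarrow> real"
  assumes "\<And>x. 0 \<le> f x"
  shows "ennreal (integral\<^sup>L M f) \<le> (\<integral>\<^sup>+x. ennreal (f x) \<partial>M)"
proof (cases "integrable M f")
  case True
  then show ?thesis
    using assms by (simp add: nn_integral_eq_integral)
next
  case False
  then show ?thesis
    by (simp add: not_integrable_integral_eq)
qed

lemma E1_nonneg: "0 \<le> E1 x"
  unfolding E1_def set_lebesgue_integral_def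
  by (rule Bochner_Integration.integral_nonneg) (auto simp: indicator_def)

text \<open>By Tonelli, exchanging the integrals over \<open>\<eta>\<close> and over the variable \<open>r\<close> of the exponential
  integral: for given \<open>r\<close> the admissible \<open>\<eta>\<close> form an interval of length \<open>2 r / \<alpha>\<close>, which cancels
  the singularity \<open>1 / r\<close>.\<close>

lemma nn_integral_radiation_kernel_le:
  assumes \<alpha>: "\<alpha> > 0"
  shows "(\<integral>\<^sup>+\<eta>. ennreal (\<alpha> * E1 (\<alpha> * (y - \<eta>)) / 2) \<partial>lborel) \<le> 1"
proof -
  let ?g = "\<lambda>\<eta> r. ennreal (\<alpha> / 2 * (indicator {\<bar>\<alpha> * (y - \<eta>)\<bar>..} r * (exp (- r) / r)))"
  have "(\<integral>\<^sup>+\<eta>. ennreal (\<alpha> * E1 (\<alpha> * (y - \<eta>)) / 2) \<partial>lborel)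
      \<le> (\<integral>\<^sup>+\<eta>. (\<integral>\<^sup>+r. ?g \<eta> r \<partial>lborel) \<partial>lborel)"
  proof (rule nn_integral_mono)
    fix \<eta>
    have "\<alpha> * E1 (\<alpha> * (y - \<eta>)) / 2
        = (\<integral>r. \<alpha> / 2 * (indicator {\<bar>\<alpha> * (y - \<eta>)\<bar>..} r * (exp (- r) / r)) \<partial>lborel)"
      unfolding E1_def set_lebesgue_integral_def by (subst integral_mult_right_zero) simp
    then show "ennreal (\<alpha> * E1 (\<alpha> * (y - \<eta>)) / 2) \<le> (\<integral>\<^sup>+r. ?g \<eta> r \<partial>lborel)"
      using \<alpha> by (auto intro!: ennreal_integral_le_nn_integral simp: indicator_def)
  qed
  also have "\<dots> = (\<integral>\<^sup>+r. (\<integral>\<^sup>+\<eta>. ?g \<eta> r \<partial>lborel) \<partial>lborel)"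
  proof (rule lborel_pair.Fubini')
    have "(\<lambda>(r, \<eta>). ?g \<eta> r) = (\<lambda>p. ennreal (\<alpha> / 2 *
        ((if \<bar>\<alpha> * (y - snd p)\<bar> \<le> fst p then 1 else 0) * (exp (- fst p) / fst p))))"
      by (auto simp: indicator_def fun_eq_iff)
    also have "\<dots> \<in> borel_measurable (lborel \<Otimes>\<^sub>M lborel)"
      by measurable
    finally show "(\<lambda>(r, \<eta>). ?g \<eta> r) \<in> borel_measurable (lborel \<Otimes>\<^sub>M lborel)" .
  qed
  also have "\<dots> \<le> (\<integral>\<^sup>+r. ennreal (exp (- r)) * indicator {0..} r \<partial>lborel)"
  proof (rule nn_integral_mono)
    fix r :: real
    show "(\<integral>\<^sup>+\<eta>. ?g \<eta> r \<partial>lborel) \<le> ennreal (exp (- r)) * indicator {0..} r"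
    proof (cases "r > 0")
      case True
      have "?g \<eta> r = ennreal (\<alpha> / 2 * (exp (- r) / r)) * indicator {y - r / \<alpha>..y + r / \<alpha>} \<eta>" for \<eta>
      proof -
        have "\<bar>\<alpha> * (y - \<eta>)\<bar> \<le> r \<longleftrightarrow> \<eta> \<in> {y - r / \<alpha>..y + r / \<alpha>}"
          using \<alpha> by (auto simp: abs_le_iff field_simps)
        then show ?thesis
          by (auto simp: indicator_def)
      qed
      then have "(\<integral>\<^sup>+\<eta>. ?g \<eta> r \<partial>lborel)
          = ennreal (\<alpha> / 2 * (exp (- r) / r)) * emeasure lborel {y - r / \<alpha>..y + r / \<alpha>}"
        by (simp add: nn_integral_cmult_indicator)
      also have "\<dots> = ennreal (\<alpha> / 2 * (exp (- r) / r)) * ennreal (2 * r / \<alpha>)"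
        using True \<alpha> by (subst emeasure_lborel_Icc) auto
      also have "\<dots> = ennreal (\<alpha> / 2 * (exp (- r) / r) * (2 * r / \<alpha>))"
        using True \<alpha> by (subst ennreal_mult) auto
      also have "\<alpha> / 2 * (exp (- r) / r) * (2 * r / \<alpha>) = exp (- r)"
        using True \<alpha> by simp
      finally show ?thesis
        using True by simp
    next
      case False
      then have "?g \<eta> r = 0" for \<eta>
        by (cases "r = 0") (auto simp: indicator_def)
      then show ?thesis
        by simp
    qed
  qed
  also have "\<dots> = ennreal (0 - (- exp (- 0)))"
  proof (rule nn_integral_FTC_atLeast)
    show "((\<lambda>r. - exp (- r)) \<longlongrightarrow> (0::real)) at_top"
      using tendsto_minus[OF filterlim_compose[OF exp_at_bot filterlim_uminus_at_bot_at_top]] by simp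
  qed (auto intro!: derivative_eq_intros)
  finally show ?thesis
    by simp
qed

lemma radiation_integral_nonneg:
  assumes "\<alpha> > 0" "\<And>\<eta>. \<eta> \<ge> 0 \<Longrightarrow> 0 \<le> g \<eta>"
  shows "0 \<le> (LBINT \<eta>:{0..}. \<alpha> * E1 (\<alpha> * (y - \<eta>)) / 2 * g \<eta>)"
  unfolding set_lebesgue_integral_def
  using assms E1_nonneg by (intro Bochner_Integration.integral_nonneg) (auto simp: indicator_def)

lemma radiation_integral_le:
  assumes \<alpha>: "\<alpha> > 0" and g: "\<And>\<eta>. \<eta> \<ge> 0 \<Longrightarrow> 0 \<le> g \<eta> \<and> g \<eta> \<le> G"
  shows "(LBINT \<eta>:{0..}. \<alpha> * E1 (\<alpha> * (y - \<eta>)) / 2 * g \<eta>) \<le> G"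
proof -
  have G: "G \<ge> 0"
    using g[of 0] by auto
  let ?k = "\<lambda>\<eta>. \<alpha> * E1 (\<alpha> * (y - \<eta>)) / 2"
  have k: "?k \<eta> \<ge> 0" for \<eta>
    using \<alpha> E1_nonneg by auto
  have "ennreal (LBINT \<eta>:{0..}. ?k \<eta> * g \<eta>)
      \<le> (\<integral>\<^sup>+\<eta>. ennreal (indicator {0..} \<eta> * (?k \<eta> * g \<eta>)) \<partial>lborel)"
    unfolding set_lebesgue_integral_def real_scaleR_def
    by (rule ennreal_integral_le_nn_integral) (use k g in \<open>auto simp: indicator_def\<close>)
  also have "\<dots> \<le> (\<integral>\<^sup>+\<eta>. ennreal G * ennreal (?k \<eta>) \<partial>lborel)"
  proof (rule nn_integral_mono)
    fix \<eta>
    have "indicator {0..} \<eta> * (?k \<eta> * g \<eta>) \<le> G * ?k \<eta>"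
      using mult_right_mono[of "g \<eta>" G "?k \<eta>"] g[of \<eta>] k[of \<eta>] G
      by (cases "\<eta> \<ge> 0") (simp_all add: mult.commute)
    then show "ennreal (indicator {0..} \<eta> * (?k \<eta> * g \<eta>)) \<le> ennreal G * ennreal (?k \<eta>)"
      using G k[of \<eta>] by (simp add: ennreal_mult[symmetric] ennreal_leI)
  qed
  also have "\<dots> \<le> ennreal G * 1"
  proof -
    have "(\<lambda>x. E1 x) \<in> borel_measurable borel"
    proof -
      have "E1 = (\<lambda>x. \<integral>r. (if \<bar>x\<bar> \<le> r then 1 else 0) * (exp (- r) / r) \<partial>lborel)"
        by (auto simp: E1_def set_lebesgue_integral_def fun_eq_iff indicator_def
            intro!: Bochner_Integration.integral_cong)
      also have "\<dots> \<in> borel_measurable borel"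
        by measurable
      finally show ?thesis .
    qed
    then have "(\<lambda>\<eta>. ennreal (?k \<eta>)) \<in> borel_measurable lborel"
      by measurable
    then have "(\<integral>\<^sup>+\<eta>. ennreal G * ennreal (?k \<eta>) \<partial>lborel)
        = ennreal G * (\<integral>\<^sup>+\<eta>. ennreal (?k \<eta>) \<partial>lborel)"
      by (rule nn_integral_cmult)
    then show ?thesis
      using mult_left_mono[OF nn_integral_radiation_kernel_le[OF \<alpha>, of y], of "ennreal G"] by simp
  qed
  finally show ?thesis
    using G by (simp add: ennreal_le_iff)
qed

section \<open>The two phases\<close>

text \<open>In the reflected coordinate the first phase solves a heat equation with drift on the same
  half-line as the second one, so both are covered by the comparison results above.\<close>

lemma first_phase_bounds:
  assumes "K > 0" "C > 0"
    and sol: "classical_solution K C L \<alpha> TM \<delta> u0 T u1 u2 s"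
    and u0: "\<And>y. y < 0 \<Longrightarrow> 0 < u0 y"
    and t: "t \<in> {0..T}"
  shows "y \<le> 0 \<Longrightarrow> 0 \<le> u1 t y" and "y < 0 \<Longrightarrow> 0 < u1 t y"
proof -
  obtain u1t u1y u1yy ds where reg: "phase_regular \<delta> T {..0} u1 u1t u1y u1yy"
    and ds: "continuous_on {0..T} ds"
    and pde: "\<forall>t\<in>{0<..T}. \<forall>y<0. u1t t y - ds t * u1y t y = K / C * u1yy t y"
    and bc: "\<forall>t\<in>{0..T}. u1 t 0 = 0 \<and> u2 t 0 = 0"
    and init: "\<forall>y<0. u1 0 y = u0 y"
    using sol unfolding classical_solution_def by blast
  have zero: "u1 t 0 = 0" if "t \<in> {0..T}" for t
    using bc that by blast
  obtain B where "\<forall>x\<in>ds ` {0..T}. norm x \<le> B"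
    using compact_imp_bounded[OF compact_continuous_image[OF ds compact_Icc]]
    unfolding bounded_iff by blast
  then have B: "\<bar>ds t\<bar> \<le> B" if "t \<in> {0..T}" for t
    using that by simp
  have "bounded ((\<lambda>(t, y). u1 t y) ` ({0..T} \<times> {..0}))"
    using reg by (simp add: phase_regular_def)
  then obtain N where "\<forall>x\<in>(\<lambda>(t, y). u1 t y) ` ({0..T} \<times> {..0}). norm x \<le> N"
    unfolding bounded_iff by blast
  then have N: "\<bar>u1 t y\<bar> \<le> N" if "t \<in> {0..T}" "y \<le> 0" for t y
    using that by auto
  define v where "v = (\<lambda>t y. u1 t (- y))"
  have sup: "supersolution (K / C) (\<lambda>t y. - ds t) (\<lambda>t y. 0) (\<lambda>t y. 0) T {0..} v"
  proof (rule supersolutionI[where vt = "\<lambda>t y. u1t t (- y)" and vy = "\<lambda>t y. - u1y t (- y)"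
        and vyy = "\<lambda>t y. u1yy t (- y)"])
    have "continuous_on ({0..T} \<times> {..0}) (\<lambda>(t, y). u1 t y)"
      using reg by (simp add: phase_regular_def)
    moreover have "continuous_on ({0..T} \<times> {0..}) (\<lambda>(t, y). (t, - y) :: real \<times> real)"
      by (auto simp: split_def intro!: continuous_intros)
    moreover have "(\<lambda>(t, y). (t, - y)) ` ({0..T} \<times> {0..}) \<subseteq> {0..T} \<times> {..0::real}"
      by auto
    ultimately have "continuous_on ({0..T} \<times> {0..}) (\<lambda>x. case (case x of (t, y) \<Rightarrow> (t, - y))
        of (t, y) \<Rightarrow> u1 t y)"
      by (rule continuous_on_compose2)
    then show "continuous_on ({0..T} \<times> {0..}) (\<lambda>(t, y). v t y)"
      by (simp add: v_def split_def)
  next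
    fix t y assume ty: "t \<in> {0<..T}" "y \<in> interior {0::real..}"
    then have y: "y > 0"
      by simp
    have "at (- y) within {..0} = at (- y)"
      using y by (intro at_within_interior) simp
    then have D: "((\<lambda>\<tau>. u1 \<tau> (- y)) has_real_derivative u1t t (- y)) (at t within {0..T})"
      "(u1 t has_real_derivative u1y t (- y)) (at (- y))"
      "(u1y t has_real_derivative u1yy t (- y)) (at (- y))"
      using reg ty(1) y unfolding phase_regular_def by (metis atMost_iff neg_le_0_iff_le less_imp_le)+
    show "((\<lambda>\<tau>. v \<tau> y) has_real_derivative u1t t (- y)) (at t within {0..T})"
      using D(1) by (simp add: v_def)
    show "(v t has_real_derivative - u1y t (- y)) (at y)"
      using D(2) by (simp add: v_def DERIV_mirror)
    show "((\<lambda>y. - u1y t (- y)) has_real_derivative u1yy t (- y)) (at y)"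
      using D(3) DERIV_minus[of "\<lambda>y. u1y t (- y)" "- u1yy t (- y)"] by (simp add: DERIV_mirror)
    show "0 \<le> u1t t (- y) - - ds t * - u1y t (- y) - K / C * u1yy t (- y) + 0 * v t y"
      using pde ty(1) y by simp
  qed
  have T0: "0 \<in> {0..T}"
    using t by auto
  have nonneg: "0 \<le> v t y" if "t \<in> {0..T}" "y \<ge> 0" for t y
    using sup
  proof (rule supersolution_nonneg_half_line[where B = B and M = 0 and N = N, OF _ _ _ _ _ _ _ _ that])
    show "0 \<le> v 0 y" if "y \<ge> 0" for y
      using that init u0[of "- y"] zero[OF T0] by (cases "y = 0") (auto simp: v_def)
    show "- N \<le> v t y" if "t \<in> {0..T}" "y \<ge> 0" for t y
      using N[OF that(1), of "- y"] that(2) by (auto simp: v_def abs_le_iff)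
  qed (use assms(1,2) B zero in \<open>auto simp: v_def\<close>)
  have pos: "0 < v t y" if "y > 0" for y
    using sup
  proof (rule supersolution_pos_half_line[where B = B and M = 0, OF _ _ _ _ _ _ _ t that])
    show "0 < v 0 y" if "y > 0" for y
      using that init u0[of "- y"] by (simp add: v_def)
  qed (use assms(1,2) B nonneg in auto)
  show "0 \<le> u1 t y" if "y \<le> 0"
    using nonneg[OF t, of "- y"] that by (simp add: v_def)
  show "0 < u1 t y" if "y < 0"
    using pos[of "- y"] that by (simp add: v_def)
qed

text \<open>With \<open>w = u2 + TM\<close>, the local part of the radiation term is \<open>w\<^sup>3 w\<close>, where \<open>w\<^sup>3\<close> is a bounded
  coefficient, and the nonlocal part is a nonnegative source. This gives \<open>w > 0\<close>.

  For \<open>z = - u2\<close> the coefficient is \<open>p = w\<^sup>3 + w\<^sup>2 TM + w TM\<^sup>2 + TM\<^sup>3\<close>, because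
  \<open>p z = TM\<^sup>4 - w\<^sup>4\<close>, and the source is \<open>TM\<^sup>4\<close> minus the nonlocal part. Its sign would follow from
  \<open>w \<le> TM\<close>, that is, from the claim \<open>z \<ge> 0\<close> itself. The circle is broken by a contraction. Let \<open>p \<le> P\<close>.
  If \<open>z \<ge> - n exp (2 P t)\<close>, then \<open>w\<^sup>4 \<le> TM\<^sup>4 + P n exp (2 P t)\<close>; as the kernel has mass at most \<open>1\<close>, the
  source is at least \<open>- P n exp (2 P t)\<close>, and this is compensated by the time derivative of
  \<open>(n / 2) exp (2 P t)\<close>. Hence \<open>z \<ge> - (n / 2) exp (2 P t)\<close>, and by iteration \<open>z \<ge> 0\<close>. Now the
  source is known to be nonnegative, and \<open>z > 0\<close> follows.\<close>

lemma second_phase_bounds: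
  assumes \<alpha>: "\<alpha> > 0" and TM: "TM > 0"
    and sol: "classical_solution K C L \<alpha> TM \<delta> u0 T u1 u2 s"
    and u0: "\<And>y. y > 0 \<Longrightarrow> - TM < u0 y \<and> u0 y < 0"
    and t: "t \<in> {0..T}"
  shows "y \<ge> 0 \<Longrightarrow> - TM \<le> u2 t y \<and> u2 t y \<le> 0" and "y > 0 \<Longrightarrow> - TM < u2 t y \<and> u2 t y < 0"
proof -
  obtain u2t u2y u2yy ds where reg: "phase_regular \<delta> T {0..} u2 u2t u2y u2yy"
    and ds: "continuous_on {0..T} ds"
    and pde: "\<forall>t\<in>{0<..T}. \<forall>y>0. u2t t y - ds t * u2y t y =
         u2yy t y - radiation \<alpha> (\<lambda>\<tau> \<eta>. u2 \<tau> \<eta> + TM) t y"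
    and bc: "\<forall>t\<in>{0..T}. u1 t 0 = 0 \<and> u2 t 0 = 0"
    and init: "\<forall>y>0. u2 0 y = u0 y"
    using sol unfolding classical_solution_def by blast
  have zero: "u2 t 0 = 0" if "t \<in> {0..T}" for t
    using bc that by blast
  obtain B where "\<forall>x\<in>ds ` {0..T}. norm x \<le> B"
    using compact_imp_bounded[OF compact_continuous_image[OF ds compact_Icc]]
    unfolding bounded_iff by blast
  then have B: "\<bar>ds t\<bar> \<le> B" if "t \<in> {0..T}" for t
    using that by simp
  have "bounded ((\<lambda>(t, y). u2 t y) ` ({0..T} \<times> {0..}))"
    using reg by (simp add: phase_regular_def)
  then obtain N where "\<forall>x\<in>(\<lambda>(t, y). u2 t y) ` ({0..T} \<times> {0..}). norm x \<le> N"
    unfolding bounded_iff by blast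
  then have N: "\<bar>u2 t y\<bar> \<le> N" if "t \<in> {0..T}" "y \<ge> 0" for t y
    using that by auto
  have T0: "0 \<in> {0..T}"
    using t by auto
  have N0: "N \<ge> 0"
    using N[OF t, of 0] by simp
  have cont: "continuous_on ({0..T} \<times> {0..}) (\<lambda>(t, y). u2 t y)"
    using reg by (simp add: phase_regular_def)
  have D: "((\<lambda>\<tau>. u2 \<tau> y) has_real_derivative u2t t y) (at t within {0..T})"
    "(u2 t has_real_derivative u2y t y) (at y)" "(u2y t has_real_derivative u2yy t y) (at y)"
    if "t \<in> {0<..T}" "y > 0" for t y
  proof -
    have "at y within {0..} = at y"
      using that by (intro at_within_interior) simp
    then show "((\<lambda>\<tau>. u2 \<tau> y) has_real_derivative u2t t y) (at t within {0..T})"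
      "(u2 t has_real_derivative u2y t y) (at y)" "(u2y t has_real_derivative u2yy t y) (at y)"
      using reg that unfolding phase_regular_def by (metis atLeast_iff less_imp_le)+
  qed
  define w where "w = (\<lambda>t y. u2 t y + TM)"
  define I where "I = (\<lambda>t y. LBINT \<eta>:{0..}. \<alpha> * E1 (\<alpha> * (y - \<eta>)) / 2 * w t \<eta> ^ 4)"
  have eq: "u2t t y - ds t * u2y t y - u2yy t y = I t y - w t y ^ 4"
    if "t \<in> {0<..T}" "y > 0" for t y
    using pde that by (simp add: radiation_def I_def w_def)
  have w_le: "\<bar>w t y\<bar> \<le> N + TM" if "t \<in> {0..T}" "y \<ge> 0" for t y
    using N[OF that] TM by (simp add: w_def)

  have sup_w: "supersolution 1 (\<lambda>t y. ds t) (\<lambda>t y. w t y ^ 3) I T {0..} w"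
  proof (rule supersolutionI[where vt = u2t and vy = u2y and vyy = u2yy])
    show "continuous_on ({0..T} \<times> {0..}) (\<lambda>(t, y). w t y)"
      using cont by (auto simp: w_def split_def intro!: continuous_intros)
  next
    fix t y assume "t \<in> {0<..T}" "y \<in> interior {0::real..}"
    then have ty: "t \<in> {0<..T}" "y > 0"
      by auto
    show "((\<lambda>\<tau>. w \<tau> y) has_real_derivative u2t t y) (at t within {0..T})"
      "(w t has_real_derivative u2y t y) (at y)" "(u2y t has_real_derivative u2yy t y) (at y)"
      using D[OF ty] by (auto simp: w_def intro!: derivative_eq_intros)
    show "I t y \<le> u2t t y - ds t * u2y t y - 1 * u2yy t y + w t y ^ 3 * w t y"
      using eq[OF ty] by (simp add: power_numeral_reduce mult_ac)
  qed
  have I_nonneg: "0 \<le> I t y" for t y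
    unfolding I_def by (rule radiation_integral_nonneg[OF \<alpha>]) simp
  have w3: "\<bar>w t y ^ 3\<bar> \<le> (N + TM) ^ 3" if "t \<in> {0<..T}" "y > 0" for t y
    unfolding power_abs using w_le[of t y] that by (intro power_mono) auto
  have w_nonneg: "0 \<le> w t y" if "t \<in> {0..T}" "y \<ge> 0" for t y
    using sup_w
  proof (rule supersolution_nonneg_half_line[OF _ _ _ _ w3 _ _ _ that, where B = B and N = "N + TM"])
    show "0 \<le> w 0 y" if "y \<ge> 0" for y
      using that init u0[of y] zero[OF T0] TM by (cases "y = 0") (auto simp: w_def)
    show "- (N + TM) \<le> w t y" if "t \<in> {0..T}" "y \<ge> 0" for t y
      using w_le[OF that] by (simp add: abs_le_iff)
    show "0 \<le> w t 0" if "t \<in> {0..T}" for t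
      using zero[OF that] TM by (simp add: w_def)
  qed (use I_nonneg B in auto)
  have w_pos: "0 < w t y" if "y > 0" for y
    using sup_w
  proof (rule supersolution_pos_half_line[OF _ _ _ _ w3 _ _ t that, where B = B])
    show "0 < w 0 y" if "y > 0" for y
      using init that u0[OF that] by (simp add: w_def)
  qed (use I_nonneg B w_nonneg in auto)

  define z where "z = (\<lambda>t y. - u2 t y)"
  define p where "p = (\<lambda>t y. w t y ^ 3 + w t y ^ 2 * TM + w t y * TM ^ 2 + TM ^ 3)"
  define P where "P = (N + TM) ^ 3 + (N + TM) ^ 2 * TM + (N + TM) * TM ^ 2 + TM ^ 3"
  have pz: "p t y * z t y = TM ^ 4 - w t y ^ 4" for t y
    unfolding p_def z_def w_def by algebra
  have p: "0 \<le> p t y" "p t y \<le> P" if "t \<in> {0..T}" "y \<ge> 0" for t y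
  proof -
    note w = w_nonneg[OF that] w_le[OF that]
    show "0 \<le> p t y"
      using w TM by (simp add: p_def)
    show "p t y \<le> P"
      unfolding p_def P_def using w TM by (intro add_mono mult_right_mono power_mono) auto
  qed
  have "P > 0"
    using N0 TM unfolding P_def by (intro add_nonneg_pos) auto
  define q where "q = (\<lambda>n t. n * exp (2 * P * t))"
  \<comment> \<open>The case \<open>n = 0\<close> is the equation for \<open>z\<close> itself.\<close>
  have sup_z: "supersolution 1 (\<lambda>t y. ds t) p (\<lambda>t y. TM ^ 4 - I t y + 2 * P * q n t) T {0..}
      (\<lambda>t y. z t y + q n t)" if "n \<ge> 0" for n
  proof (rule supersolutionI[where vt = "\<lambda>t y. - u2t t y + 2 * P * q n t"
        and vy = "\<lambda>t y. - u2y t y" and vyy = "\<lambda>t y. - u2yy t y"])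
    show "continuous_on ({0..T} \<times> {0..}) (\<lambda>(t, y). z t y + q n t)"
      using cont by (auto simp: z_def q_def split_def intro!: continuous_intros)
  next
    fix t y assume "t \<in> {0<..T}" "y \<in> interior {0::real..}"
    then have ty: "t \<in> {0<..T}" "y > 0"
      by auto
    show "((\<lambda>\<tau>. z \<tau> y + q n \<tau>) has_real_derivative - u2t t y + 2 * P * q n t) (at t within {0..T})"
      "((\<lambda>y. z t y + q n t) has_real_derivative - u2y t y) (at y)"
      "((\<lambda>y. - u2y t y) has_real_derivative - u2yy t y) (at y)"
      using D[OF ty] by (auto simp: z_def q_def intro!: derivative_eq_intros)
    have "0 \<le> p t y * q n t"
      using p[of t y] ty that by (auto simp: q_def)
    then show "TM ^ 4 - I t y + 2 * P * q n t
        \<le> - u2t t y + 2 * P * q n t - ds t * - u2y t y - 1 * - u2yy t y + p t y * (z t y + q n t)"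
      using eq[OF ty] pz[of t y] by (simp add: algebra_simps)
  qed
  have z_init: "0 \<le> z 0 y" if "y \<ge> 0" for y
    using that init u0[of y] zero[OF T0] by (cases "y = 0") (auto simp: z_def)
  have halve: "- q (n / 2) t \<le> z t y"
    if n: "n \<ge> 0" and z: "\<And>t y. t \<in> {0..T} \<Longrightarrow> y \<ge> 0 \<Longrightarrow> - q n t \<le> z t y"
      and ty: "t \<in> {0..T}" "y \<ge> 0" for n t y
  proof -
    have q: "0 \<le> q m t" if "m \<ge> 0" for m t
      using that by (simp add: q_def)
    have I_le: "I t y \<le> TM ^ 4 + P * q n t" if "t \<in> {0..T}" for t y
      unfolding I_def
    proof (rule radiation_integral_le[OF \<alpha>])
      fix \<eta> :: real assume \<eta>: "\<eta> \<ge> 0"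
      have "p t \<eta> * - q n t \<le> p t \<eta> * z t \<eta>"
        using p[OF that \<eta>] z[OF that \<eta>] by (intro mult_left_mono)
      moreover have "p t \<eta> * q n t \<le> P * q n t"
        using p[OF that \<eta>] q[OF n] by (intro mult_right_mono)
      ultimately show "0 \<le> w t \<eta> ^ 4 \<and> w t \<eta> ^ 4 \<le> TM ^ 4 + P * q n t"
        using pz[of t \<eta>] by simp
    qed
    have "0 \<le> z t y + q (n / 2) t"
    proof (rule supersolution_nonneg_half_line[OF sup_z _ _ _ _ _ _ _ ty, where B = B and M = P and N = N])
      show "0 \<le> TM ^ 4 - I t y + 2 * P * q (n / 2) t" if "t \<in> {0<..T}" for t y
        using I_le[of t y] that by (simp add: q_def)
      show "\<bar>p t y\<bar> \<le> P" if "t \<in> {0<..T}" "y > 0" for t y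
        using p[of t y] that by simp
      show "- N \<le> z t y + q (n / 2) t" if "t \<in> {0..T}" "y \<ge> 0" for t y
        using N[OF that] q[of "n / 2" t] n by (simp add: z_def abs_le_iff)
      show "0 \<le> z 0 y + q (n / 2) 0" if "y \<ge> 0" for y
        using z_init[OF that] q[of "n / 2" 0] n by simp
      show "0 \<le> z t 0 + q (n / 2) t" if "t \<in> {0..T}" for t
        using zero[OF that] q[of "n / 2" t] n by (simp add: z_def)
    qed (use n B in auto)
    then show ?thesis
      by simp
  qed
  have iterate: "- q (N / 2 ^ k) t \<le> z t y" if "t \<in> {0..T}" "y \<ge> 0" for k t y
    using that
  proof (induction k arbitrary: t y)
    case 0
    have "N * 1 \<le> N * exp (2 * P * t)"
      using N0 0 \<open>P > 0\<close> by (intro mult_left_mono) auto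
    then show ?case
      using N[OF 0] by (simp add: q_def z_def abs_le_iff)
  next
    case (Suc k)
    show ?case
      using halve[of "N / 2 ^ k", OF _ Suc.IH Suc.prems] N0 by (simp add: mult.commute)
  qed
  have z_nonneg: "0 \<le> z t y" if "t \<in> {0..T}" "y \<ge> 0" for t y
  proof (rule LIMSEQ_le_const2)
    have "(\<lambda>k. - (N * exp (2 * P * t)) * (1 / 2) ^ k) \<longlonglongrightarrow> - (N * exp (2 * P * t)) * 0"
      by (intro tendsto_intros LIMSEQ_power_zero) simp
    then show "(\<lambda>k. - q (N / 2 ^ k) t) \<longlonglongrightarrow> 0"
      by (simp add: q_def power_one_over field_simps)
    show "\<exists>k0. \<forall>k\<ge>k0. - q (N / 2 ^ k) t \<le> z t y"
      using iterate[OF that] by blast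
  qed
  have I_le: "I t y \<le> TM ^ 4" if "t \<in> {0..T}" for t y
    unfolding I_def
  proof (rule radiation_integral_le[OF \<alpha>])
    show "0 \<le> w t \<eta> ^ 4 \<and> w t \<eta> ^ 4 \<le> TM ^ 4" if "\<eta> \<ge> 0" for \<eta>
      using mult_nonneg_nonneg[OF p(1) z_nonneg, OF \<open>t \<in> {0..T}\<close> that \<open>t \<in> {0..T}\<close> that] pz[of t \<eta>]
      by simp
  qed
  have z_pos: "0 < z t y" if "y > 0" for y
  proof (rule supersolution_pos_half_line[OF _ _ _ _ _ z_nonneg _ t that, where B = B and M = P])
    show "supersolution 1 (\<lambda>t y. ds t) p (\<lambda>t y. TM ^ 4 - I t y) T {0..} z"
      using sup_z[of 0] by (simp add: q_def)
    show "0 < z 0 y" if "y > 0" for y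
      using init that u0[OF that] by (simp add: z_def)
    show "\<bar>p t y\<bar> \<le> P" if "t \<in> {0<..T}" "y > 0" for t y
      using p[of t y] that by simp
  qed (use I_le B in auto)
  show "- TM \<le> u2 t y \<and> u2 t y \<le> 0" if "y \<ge> 0"
    using w_nonneg[OF t that] z_nonneg[OF t that] by (simp add: w_def z_def)
  show "- TM < u2 t y \<and> u2 t y < 0" if "y > 0"
    using w_pos[OF that] z_pos[OF that] by (simp add: w_def z_def)
qed

theorem proposition2p3:
  fixes K C L \<alpha> TM \<delta> :: real
    and u0 :: "real \<Rightarrow> real"
    and J :: "real set"
    and u1 u2 :: "real \<Rightarrow> real \<Rightarrow> real"
    and s :: "real \<Rightarrow> real"
  assumes "K > 0" "C > 0" "L > 0" "\<alpha> > 0" "TM > 0"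
    and "0 < \<delta>" "\<delta> < 1 / 2"
    and "C_holder 0 1 UNIV u0" "bounded (range u0)"
    and "u0 0 = 0"
    and "\<And>y. y < 0 \<Longrightarrow> u0 y > 0"
    and "\<And>y. y > 0 \<Longrightarrow> - TM < u0 y \<and> u0 y < 0"
    and "C_holder 2 \<delta> {..<0} u0" "C_holder 2 \<delta> {0<..} u0"
    and "maximal_classical_solution K C L \<alpha> TM \<delta> u0 J u1 u2 s"
  shows "(\<forall>t\<in>J. \<forall>y\<le>0. u1 t y \<ge> 0) \<and>
         (\<forall>t\<in>J. \<forall>y\<ge>0. - TM \<le> u2 t y \<and> u2 t y \<le> 0) \<and>
         (\<forall>a b. {a<..<b} \<subseteq> {..0} \<longrightarrow> (\<forall>t\<in>J. \<forall>y\<in>{a<..<b}. u1 t y > 0)) \<and>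
         (\<forall>a b. {a<..<b} \<subseteq> {0..} \<longrightarrow> (\<forall>t\<in>J. \<forall>y\<in>{a<..<b}. - TM < u2 t y \<and> u2 t y < 0))"
proof -
  have sol: "\<exists>T. t \<in> {0..T} \<and> classical_solution K C L \<alpha> TM \<delta> u0 T u1 u2 s" if "t \<in> J" for t
  proof -
    have on: "classical_solution_on K C L \<alpha> TM \<delta> u0 J u1 u2 s"
      using assms(15) by (simp add: maximal_classical_solution_def)
    \<comment> \<open>The initial time belongs to the solution on any \<open>[0,T]\<close> with \<open>T > 0\<close>; one such \<open>T\<close> exists.\<close>
    then obtain T0 where T0: "T0 \<in> J" "T0 > 0"
      unfolding classical_solution_on_def by force
    show ?thesis
    proof (cases "t = 0")
      case True
      then show ?thesis
        using on T0 unfolding classical_solution_on_def by (intro exI[of _ T0]) auto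
    next
      case False
      then show ?thesis
        using on that unfolding classical_solution_on_def by (intro exI[of _ t]) force
    qed
  qed
  have first: "(y \<le> 0 \<longrightarrow> 0 \<le> u1 t y) \<and> (y < 0 \<longrightarrow> 0 < u1 t y)" if "t \<in> J" for t y
  proof -
    obtain T where T: "t \<in> {0..T}" "classical_solution K C L \<alpha> TM \<delta> u0 T u1 u2 s"
      using sol[OF \<open>t \<in> J\<close>] by blast
    show ?thesis
      using first_phase_bounds[OF assms(1,2) T(2) assms(11) T(1)] by blast
  qed
  have second: "(y \<ge> 0 \<longrightarrow> - TM \<le> u2 t y \<and> u2 t y \<le> 0) \<and>
      (y > 0 \<longrightarrow> - TM < u2 t y \<and> u2 t y < 0)" if "t \<in> J" for t y
  proof -
    obtain T where T: "t \<in> {0..T}" "classical_solution K C L \<alpha> TM \<delta> u0 T u1 u2 s"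
      using sol[OF \<open>t \<in> J\<close>] by blast
    show ?thesis
      using second_phase_bounds[OF assms(4,5) T(2) assms(12) T(1)] by blast
  qed
  have neg: "y < 0" if "{a<..<b} \<subseteq> {..0::real}" "y \<in> {a<..<b}" for a b y
    using interior_mono[OF that(1)] that(2) by auto
  have pos: "y > 0" if "{a<..<b} \<subseteq> {0::real..}" "y \<in> {a<..<b}" for a b y
    using interior_mono[OF that(1)] that(2) by auto
  show ?thesis
    using first second neg pos by blast
qed

end
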